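(* Let $n$ be a positive integer and let $\mathcal{A}=(A_1,\dots,A_{2n-1})$ be a family of $2n-1$ (not necessarily distinct) sets, each consisting of $n$ mutually disjoint line segments in the plane, of which $n-1$ are horizontal and one is vertical. Then $\mathcal{A}$ has an SDR of size $n$.
   Context: A horizontal (resp. vertical) line segment is a line segment contained in a line of the form $\mathbb{R}\times\{y\}$ (resp. $\{x\}\times\mathbb{R}$). Given families $A_1,\dots,A_N$ of nonempty sets, a system of disjoint representatives (SDR) of size $n$ is a set $\{S_1,\dots,S_n\}$ of mutually disjoint sets in $\bigcup_i A_i$ such that there are distinct indices $p_1,\dots,p_n\in[N]$ with $S_j\in A_{p_j}$ for all $j\in[n]$. *)

theory Defs
  imports "HOL-Analysis.Analysis"
begin

text \<open>
  Segments are closed, and, as with the library's \<open>closed_segment\<close>, the endpoints may coincide.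
  A one-point segment is then both horizontal and vertical.
\<close>

definition line_segment :: "(real \<times> real) set \<Rightarrow> bool" where
  "line_segment S \<longleftrightarrow> (\<exists>a b. S = closed_segment a b)"

definition horizontal_segment :: "(real \<times> real) set \<Rightarrow> bool" where
  "horizontal_segment S \<longleftrightarrow> line_segment S \<and> (\<exists>y. S \<subseteq> UNIV \<times> {y})"

definition vertical_segment :: "(real \<times> real) set \<Rightarrow> bool" where
  "vertical_segment S \<longleftrightarrow> line_segment S \<and> (\<exists>x. S \<subseteq> {x} \<times> UNIV)"

text \<open>
  \<open>R\<close> is a system of disjoint representatives of size \<open>n\<close> for the families \<open>A 1, \<dots>, A N\<close>.
  The notion is meant for families of nonempty sets; then the \<open>S j\<close> are distinct, since they are
  disjoint, and \<open>card R = n\<close>.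
\<close>

definition is_SDR :: "nat \<Rightarrow> (nat \<Rightarrow> 'a set set) \<Rightarrow> nat \<Rightarrow> 'a set set \<Rightarrow> bool" where
  "is_SDR N A n R \<longleftrightarrow>
     (\<exists>S p. R = S ` {1..n} \<and> disjoint_family_on S {1..n} \<and>
        inj_on p {1..n} \<and> (\<forall>j\<in>{1..n}. p j \<in> {1..N} \<and> S j \<in> A (p j)))"

end

(*
  Pick one segment from each family and two index sets I, J of the same maximal size m on which
  the picked segments are horizontal and disjoint, so that the sum of the right endpoints over I
  is least possible and, subject to that, the sum of the left endpoints over J is greatest
  possible. If m < n, some index i lies outside I and J, since 2(n - 1) < 2n - 1. By an exchange
  argument, every horizontal segment of A i contains the right endpoint of a segment picked over I
  and the left endpoint of one picked over J: otherwise m or one of the two sums could be improved.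
  The vertical segment V of A i misses the n - 1 horizontal segments of A i, so each of them that
  lies on a line met by V is strictly on one side of V. Replace it by the segment of I with right
  endpoint on it if it is to the left of V, and by the one of J with left endpoint on it if it is
  to the right. The resulting n - 1 segments are disjoint, avoid V and have indices other than i,
  so V completes them to size n.
*)
theory Submission
  imports Defs
begin

section \<open>Horizontal segments in coordinates\<close>

text \<open>\<open>Inf\<close> and \<open>Sup\<close> make \<open>lo\<close> and \<open>hi\<close>
  total; on a horizontal segment they are the abscissas of the two endpoints.\<close>

definition lo :: "(real \<times> real) set \<Rightarrow> real" where
  "lo S = Inf (fst ` S)"

definition hi :: "(real \<times> real) set \<Rightarrow> real" where
  "hi S = Sup (fst ` S)"

definition height :: "(real \<times> real) set \<Rightarrow> real" where
  "height S = Inf (snd ` S)"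

lemma horizontal_segment_eq:
  assumes "horizontal_segment S"
  shows "lo S \<le> hi S" and "S = {lo S..hi S} \<times> {height S}"
proof -
  obtain a b y where S: "S = closed_segment a b" and y: "S \<subseteq> UNIV \<times> {y}"
    using assms by (auto simp: horizontal_segment_def line_segment_def)
  have "a \<in> S" by (auto simp: S)
  have "fst ` S = closed_segment (fst a) (fst b)"
    unfolding S by (simp add: closed_segment_linear_image linear_fst)
  also have "\<dots> = {min (fst a) (fst b)..max (fst a) (fst b)}"
    by (simp add: closed_segment_eq_real_ivl min_def max_def)
  finally have fst: "fst ` S = {min (fst a) (fst b)..max (fst a) (fst b)}" .
  have snd: "snd ` S = {y}"
    using y \<open>a \<in> S\<close> by force
  have *: "min (fst a) (fst b) \<le> max (fst a) (fst b)" by simp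
  show "lo S \<le> hi S"
    using * by (simp add: lo_def hi_def fst del: max.bounded_iff min.bounded_iff)
  have "S = fst ` S \<times> {y}"
    using y by force
  moreover have "fst ` S = {lo S..hi S}" "height S = y"
    using * by (simp_all add: lo_def hi_def height_def fst snd del: max.bounded_iff min.bounded_iff)
  ultimately show "S = {lo S..hi S} \<times> {height S}" by simp
qed

lemma disjnt_horizontal_iff:
  assumes "horizontal_segment S" "horizontal_segment T"
  shows "disjnt S T \<longleftrightarrow> height S \<noteq> height T \<or> hi S < lo T \<or> hi T < lo S"
proof -
  have "{a..b} \<inter> {c..d} = {} \<longleftrightarrow> b < c \<or> d < a" if "a \<le> b" "c \<le> d" for a b c d :: real
    using that by (auto simp: Int_atLeastAtMost)
  moreover have "disjnt S T \<longleftrightarrow> disjnt ({lo S..hi S} \<times> {height S}) ({lo T..hi T} \<times> {height T})"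
    using horizontal_segment_eq assms by simp
  ultimately show ?thesis
    using horizontal_segment_eq(1) assms by (auto simp: disjnt_def Times_Int_Times)
qed

lemma mem_horizontal_iff:
  assumes "horizontal_segment S"
  shows "(x, y) \<in> S \<longleftrightarrow> y = height S \<and> lo S \<le> x \<and> x \<le> hi S"
  using arg_cong[OF horizontal_segment_eq(2)[OF assms], of "\<lambda>T. (x, y) \<in> T"] by auto

section \<open>Exchanging one segment of a disjoint family\<close>

text \<open>A member that meets \<open>X\<close> but whose right endpoint is outside
  \<open>X\<close> must reach beyond \<open>hi X\<close>, so it contains the right endpoint of
  \<open>X\<close>. Disjoint members cannot share that point, hence at most one meets
  \<open>X\<close>; putting \<open>X\<close> in its place lowers the sum of right endpoints.\<close>

lemma horizontal_exchange_hi: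
  assumes I: "\<And>k. k \<in> I \<Longrightarrow> horizontal_segment (f k)" "disjoint_family_on f I"
    and X: "horizontal_segment X" "\<And>k. k \<in> I \<Longrightarrow> (hi (f k), height (f k)) \<notin> X"
  shows "(\<forall>k\<in>I. disjnt X (f k)) \<or> (\<exists>k\<in>I. hi X < hi (f k) \<and> (\<forall>j\<in>I - {k}. disjnt X (f j)))"
proof (cases "\<forall>k\<in>I. disjnt X (f k)")
  case False
  have *: "height (f k) = height X \<and> lo (f k) \<le> hi X \<and> hi X < hi (f k)"
    if "k \<in> I" "\<not> disjnt X (f k)" for k
    using that X(2)[of k] by (auto simp: disjnt_horizontal_iff mem_horizontal_iff I X)
  obtain k where k: "k \<in> I" "\<not> disjnt X (f k)" using False by blast
  have "disjnt X (f j)" if "j \<in> I - {k}" for j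
  proof (rule ccontr)
    assume j: "\<not> disjnt X (f j)"
    have "disjnt (f j) (f k)"
      using I(2) k that by (auto simp: disjoint_family_on_def disjnt_def)
    then show False
      using *[of j] *[of k] j k that by (auto simp: disjnt_horizontal_iff I)
  qed
  then show ?thesis using k *[of k] by blast
qed simp

text \<open>Mirror image: every member meeting \<open>X\<close> contains the left endpoint of
  \<open>X\<close>, and the exchange raises the sum of left endpoints.\<close>

lemma horizontal_exchange_lo:
  assumes I: "\<And>k. k \<in> I \<Longrightarrow> horizontal_segment (f k)" "disjoint_family_on f I"
    and X: "horizontal_segment X" "\<And>k. k \<in> I \<Longrightarrow> (lo (f k), height (f k)) \<notin> X"
  shows "(\<forall>k\<in>I. disjnt X (f k)) \<or> (\<exists>k\<in>I. lo (f k) < lo X \<and> (\<forall>j\<in>I - {k}. disjnt X (f j)))"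
proof (cases "\<forall>k\<in>I. disjnt X (f k)")
  case False
  have *: "height (f k) = height X \<and> lo (f k) < lo X \<and> lo X \<le> hi (f k)"
    if "k \<in> I" "\<not> disjnt X (f k)" for k
    using that X(2)[of k] by (auto simp: disjnt_horizontal_iff mem_horizontal_iff I X)
  obtain k where k: "k \<in> I" "\<not> disjnt X (f k)" using False by blast
  have "disjnt X (f j)" if "j \<in> I - {k}" for j
  proof (rule ccontr)
    assume j: "\<not> disjnt X (f j)"
    have "disjnt (f j) (f k)"
      using I(2) k that by (auto simp: disjoint_family_on_def disjnt_def)
    then show False
      using *[of j] *[of k] j k that by (auto simp: disjnt_horizontal_iff I)
  qed
  then show ?thesis using k *[of k] by blast
qed simp

section \<open>Updating a choice, and passing to an SDR\<close>

lemma disjoint_family_on_update: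
  assumes "disjoint_family_on f K" "i \<notin> K" "\<And>k. k \<in> K \<Longrightarrow> disjnt X (f k)"
  shows "disjoint_family_on (f(i := X)) (insert i K)"
  using assms by (auto simp: disjoint_family_on_def disjnt_def)

lemma sum_update_swap:
  fixes w :: "'b \<Rightarrow> real"
  assumes "finite I" "k \<in> I" "i \<notin> I"
  shows "(\<Sum>j\<in>insert i (I - {k}). w ((f(i := X)) j)) = (\<Sum>j\<in>I. w (f j)) - w (f k) + w X"
proof -
  have "(\<Sum>j\<in>I - {k}. w ((f(i := X)) j)) = (\<Sum>j\<in>I - {k}. w (f j))"
    using assms by (intro sum.cong) auto
  then show ?thesis using assms by (simp add: sum_diff1)
qed

text \<open>Enumerating any \<open>n\<close> indices of \<open>K\<close> gives the injection
  \<open>p\<close>, and \<open>f \<circ> p\<close> gives the representatives.\<close>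

lemma is_SDR_of_disjoint_family:
  assumes "K \<subseteq> {1..N}" "n \<le> card K" "disjoint_family_on f K" "\<And>k. k \<in> K \<Longrightarrow> f k \<in> A k"
  shows "\<exists>R. is_SDR N A n R"
proof -
  obtain L where L: "L \<subseteq> K" "card L = n" "finite L"
    using assms(2) obtain_subset_with_card_n by metis
  then obtain p where p: "bij_betw p {1..n} L"
    using ex_bij_betw_nat_finite_1 by blast
  have inL: "p j \<in> L" if "j \<in> {1..n}" for j
    using p that by (auto simp: bij_betw_def)
  then have inK: "p j \<in> K" if "j \<in> {1..n}" for j
    using L(1) that by blast
  have inj: "inj_on p {1..n}" using p by (simp add: bij_betw_def)
  have "disjoint_family_on (f \<circ> p) {1..n}"
    unfolding disjoint_family_on_def
  proof (intro ballI impI)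
    fix a b assume ab: "a \<in> {1..n}" "b \<in> {1..n}" "a \<noteq> b"
    then have "p a \<noteq> p b" using inj by (meson inj_onD)
    then show "(f \<circ> p) a \<inter> (f \<circ> p) b = {}"
      using assms(3) L(1) inL ab by (auto simp: disjoint_family_on_def)
  qed
  then have "is_SDR N A n ((f \<circ> p) ` {1..n})"
    unfolding is_SDR_def using inj inK assms(1,4)
    by (intro exI[of _ "f \<circ> p"] exI[of _ p]) (simp add: subset_iff del: One_nat_def)
  then show ?thesis by blast
qed


section \<open>Merging two disjoint families around a vertical segment\<close>

text \<open>On a line met by \<open>V\<close>, segments taken from \<open>I\<close> end before the
  abscissa \<open>a\<close> and segments taken from \<open>J\<close> begin after it. So
  \<open>V\<close> separates the two kinds from each other and from itself, while within one kind
  disjointness is inherited from \<open>I\<close> or \<open>J\<close>.\<close>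

lemma merge_around_vertical:
  assumes B: "\<And>x. x \<in> B \<Longrightarrow> horizontal_segment x" "pairwise disjnt B"
    and f: "\<And>k. k \<in> I \<union> J \<Longrightarrow> horizontal_segment (f k)"
      "disjoint_family_on f I" "disjoint_family_on f J"
    and \<beta>: "\<And>x. x \<in> B \<Longrightarrow> \<beta> x \<in> I \<and> (hi (f (\<beta> x)), height (f (\<beta> x))) \<in> x"
    and \<gamma>: "\<And>x. x \<in> B \<Longrightarrow> \<gamma> x \<in> J \<and> (lo (f (\<gamma> x)), height (f (\<gamma> x))) \<in> x"
    and V: "V \<subseteq> {a} \<times> UNIV" "\<And>x. x \<in> B \<Longrightarrow> disjnt V x"
  obtains K where "K \<subseteq> I \<union> J" "card K = card B" "disjoint_family_on f K"
    "\<And>k. k \<in> K \<Longrightarrow> disjnt V (f k)"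
proof -
  \<comment> \<open>On lines missing \<open>V\<close> this is false, so all segments there
    consistently get their replacement from \<open>I\<close>.\<close>
  define right where "right x \<longleftrightarrow> height x \<in> snd ` V \<and> a < lo x" for x
  define \<delta> where "\<delta> x = (if right x then \<gamma> x else \<beta> x)" for x
  have \<beta>': "height (f (\<beta> x)) = height x \<and> lo x \<le> hi (f (\<beta> x)) \<and> hi (f (\<beta> x)) \<le> hi x"
    if "x \<in> B" for x
    using \<beta>[OF that] B(1)[OF that] by (simp add: mem_horizontal_iff)
  have \<gamma>': "height (f (\<gamma> x)) = height x \<and> lo x \<le> lo (f (\<gamma> x)) \<and> lo (f (\<gamma> x)) \<le> hi x"
    if "x \<in> B" for x
    using \<gamma>[OF that] B(1)[OF that] by (simp add: mem_horizontal_iff)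
  have hor: "horizontal_segment (f (\<beta> x))" "horizontal_segment (f (\<gamma> x))" if "x \<in> B" for x
    using \<beta>[OF that] \<gamma>[OF that] f(1) by auto
  have avoid: "a < lo x \<or> hi x < a" if "x \<in> B" "height x \<in> snd ` V" for x
  proof -
    have "(a, height x) \<in> V" using that(2) V(1) by force
    then have "(a, height x) \<notin> x" using V(2)[OF that(1)] by (auto simp: disjnt_def)
    then show ?thesis using B(1)[OF that(1)] by (auto simp: mem_horizontal_iff)
  qed
  have \<delta>I: "\<delta> x \<in> I \<union> J" if "x \<in> B" for x
    using \<beta>[OF that] \<gamma>[OF that] by (simp add: \<delta>_def)
  have B_disj: "disjnt x y" if "x \<in> B" "y \<in> B" "x \<noteq> y" for x y
    using B(2) that by (auto simp: pairwise_def)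
  have \<beta>_disj: "disjnt (f (\<beta> x)) (f (\<beta> y))" if "x \<in> B" "y \<in> B" "x \<noteq> y" for x y
  proof -
    \<comment> \<open>A common index would put one endpoint into both \<open>x\<close> and
      \<open>y\<close>.\<close>
    have "\<beta> x \<noteq> \<beta> y" using \<beta>[of x] \<beta>[of y] B_disj[OF that] that by (auto simp: disjnt_def)
    then show ?thesis using f(2) \<beta> that by (auto simp: disjoint_family_on_def disjnt_def)
  qed
  have \<gamma>_disj: "disjnt (f (\<gamma> x)) (f (\<gamma> y))" if "x \<in> B" "y \<in> B" "x \<noteq> y" for x y
  proof -
    have "\<gamma> x \<noteq> \<gamma> y" using \<gamma>[of x] \<gamma>[of y] B_disj[OF that] that by (auto simp: disjnt_def)
    then show ?thesis using f(3) \<gamma> that by (auto simp: disjoint_family_on_def disjnt_def)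
  qed
  have \<beta>\<gamma>_disj: "disjnt (f (\<beta> x)) (f (\<gamma> y))"
    if "x \<in> B" "y \<in> B" "right y" "\<not> right x" for x y
  proof (cases "height x = height y")
    \<comment> \<open>\<open>right y\<close> says that the common line meets \<open>V\<close>, so
      \<open>x\<close>, not being to the right of \<open>V\<close>, is to its left.\<close>
    case True
    then have "hi x < a" "a < lo y"
      using that avoid[of x] by (auto simp: right_def)
    then show ?thesis
      using that(1,2) \<beta>'[of x] \<gamma>'[of y] by (simp add: disjnt_horizontal_iff hor)
  next
    case False
    then show ?thesis
      using that(1,2) \<beta>'[of x] \<gamma>'[of y] by (simp add: disjnt_horizontal_iff hor)
  qed
  have \<delta>_disj: "disjnt (f (\<delta> x)) (f (\<delta> y))" if "x \<in> B" "y \<in> B" "x \<noteq> y" for x y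
    using \<beta>_disj[OF that] \<gamma>_disj[OF that] \<beta>\<gamma>_disj[OF that(1,2)]
      disjnt_sym[OF \<beta>\<gamma>_disj[OF that(2,1)]]
    by (cases "right x"; cases "right y") (simp_all add: \<delta>_def)
  \<comment> \<open>A nonempty set is not disjoint from itself, so disjoint replacements have
    distinct indices, even where \<open>I\<close> and \<open>J\<close> overlap.\<close>
  have ne: "f k \<noteq> {}" if "k \<in> I \<union> J" for k
    using mem_horizontal_iff[OF f(1)[OF that]] horizontal_segment_eq(1)[OF f(1)[OF that]] by blast
  have inj: "inj_on \<delta> B"
  proof (rule inj_onI, rule ccontr)
    fix x y assume "x \<in> B" "y \<in> B" "\<delta> x = \<delta> y" "x \<noteq> y"
    then show False using \<delta>_disj[of x y] ne[OF \<delta>I, of x] by (auto simp: disjnt_def)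
  qed
  show thesis
  proof
    show "\<delta> ` B \<subseteq> I \<union> J" using \<delta>I by blast
    show "card (\<delta> ` B) = card B" using inj by (rule card_image)
    show "disjoint_family_on f (\<delta> ` B)"
      using \<delta>_disj by (force simp: disjoint_family_on_def disjnt_def)
    fix k assume "k \<in> \<delta> ` B"
    then obtain x where x: "x \<in> B" "k = \<delta> x" by blast
    \<comment> \<open>All points of \<open>V\<close> have abscissa \<open>a\<close>, so only these
      points need to be tested.\<close>
    have "(a, t) \<notin> f (\<delta> x)" if "(a, t) \<in> V" for t
    proof
      assume t: "(a, t) \<in> f (\<delta> x)"
      then have "t = height x"
        using \<beta>'[OF x(1)] \<gamma>'[OF x(1)] hor[OF x(1)]
        by (simp add: \<delta>_def mem_horizontal_iff split: if_splits)
      then have ht: "height x \<in> snd ` V" using that by force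
      then show False
      proof (cases "a < lo x")
        case True
        then show False using t ht \<gamma>'[OF x(1)] hor[OF x(1)]
          by (simp add: \<delta>_def right_def mem_horizontal_iff)
      next
        case False
        then show False
          using t ht avoid[OF x(1) ht] \<beta>'[OF x(1)] hor[OF x(1)]
          by (simp add: \<delta>_def right_def mem_horizontal_iff)
      qed
    qed
    then show "disjnt V (f k)" using V(1) x(2) by (force simp: disjnt_def)
  qed
qed

section \<open>Extremal choice and completion by a vertical segment\<close>

theorem theorem4p1:
  fixes n :: nat and A :: "nat \<Rightarrow> (real \<times> real) set set"
  assumes "n \<ge> 1"
    and "\<And>i. i \<in> {1..2 * n - 1} \<Longrightarrow> card (A i) = n"
    and "\<And>i. i \<in> {1..2 * n - 1} \<Longrightarrow> pairwise disjnt (A i)"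
    and "\<And>i. i \<in> {1..2 * n - 1} \<Longrightarrow>
           \<exists>V \<in> A i. vertical_segment V \<and> (\<forall>H \<in> A i - {V}. horizontal_segment H)"
  shows "\<exists>R. is_SDR (2 * n - 1) A n R"
proof -
  define C where "C = {1..2 * n - 1}"
  have "\<forall>i\<in>C. \<exists>V. V \<in> A i \<and> vertical_segment V \<and> (\<forall>H \<in> A i - {V}. horizontal_segment H)"
    using assms(4) unfolding C_def by (simp only: Bex_def) blast
  from bchoice[OF this] obtain V where V: "\<And>i. i \<in> C \<Longrightarrow> V i \<in> A i \<and> vertical_segment (V i) \<and>
      (\<forall>H \<in> A i - {V i}. horizontal_segment H)"
    by blast
  \<comment> \<open>A one-point \<open>V i\<close> is horizontal too; removing the chosen
    \<open>V i\<close>, rather than selecting by direction, leaves exactly \<open>n - 1\<close>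
    segments.\<close>
  define B where "B i = A i - {V i}" for i
  have C: "finite C" "card C = 2 * n - 1" by (auto simp: C_def)
  have finA: "finite (A i)" if "i \<in> C" for i
    \<comment> \<open>An infinite set has \<open>card\<close> 0, which \<open>n \<ge> 1\<close>
      excludes.\<close>
    using assms(1) assms(2)[of i] that by (intro card_ge_0_finite) (simp add: C_def)
  have cardB: "card (B i) = n - 1" if "i \<in> C" for i
    using V[OF that] finA[OF that] assms(2)[of i] that by (simp add: B_def C_def)
  have horB: "horizontal_segment x" if "i \<in> C" "x \<in> B i" for i x
    using V that by (auto simp: B_def)
  have BA: "x \<in> A i" if "x \<in> B i" for i x using that by (simp add: B_def)
  \<comment> \<open>\<open>f\<close> chooses from every family, not only over \<open>I\<close>, so
    that two index sets can share it. Extensionality of \<open>PiE\<close> leaves finitely many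
    choices, so extremal ones exist.\<close>
  define good where "good f I \<longleftrightarrow> f \<in> PiE C A \<and> I \<subseteq> C \<and> disjoint_family_on f I \<and> (\<forall>k\<in>I. f k \<in> B k)"
    for f I
  have goodD: "f \<in> PiE C A" "I \<subseteq> C" "finite I" "disjoint_family_on f I" "\<And>k. k \<in> I \<Longrightarrow> f k \<in> B k"
    "\<And>k. k \<in> I \<Longrightarrow> horizontal_segment (f k)" if "good f I" for f I
    using that C(1) finite_subset horB unfolding good_def by blast+
  have finP: "finite (PiE C A \<times> Pow C)" using C(1) finA by (intro finite_cartesian_product finite_PiE) auto
  \<comment> \<open>\<open>K = I\<close> enlarges the family; \<open>K = I - {k}\<close> exchanges
    \<open>k\<close> for \<open>i\<close>.\<close>
  have update: "good (f(i := X)) (insert i K)"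
    if "good f I" "K \<subseteq> I" "i \<in> C - I" "X \<in> B i" "\<And>k. k \<in> K \<Longrightarrow> disjnt X (f k)" for f I K i X
  proof -
    have "disjoint_family_on f K"
      using that(1,2) disjoint_family_on_mono goodD(4) by blast
    then have "disjoint_family_on (f(i := X)) (insert i K)"
      using that by (intro disjoint_family_on_update) auto
    moreover have "f(i := X) \<in> PiE C A"
      using goodD(1)[OF that(1)] BA[OF that(4)] that(3) by (auto simp: PiE_iff extensional_def)
    ultimately show ?thesis
      using that(1-4) by (auto simp: good_def)
  qed
  \<comment> \<open>Lets an exchange in \<open>J\<close> change \<open>f\<close> at \<open>i\<close>
    without disturbing \<open>I\<close>.\<close>
  have update_other: "good (f(i := X)) I" if "good f I" "i \<in> C - I" "X \<in> B i" for f I i X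
  proof -
    have "disjoint_family_on (f(i := X)) I"
      using goodD(4)[OF that(1)] that(2) by (auto simp: disjoint_family_on_def)
    moreover have "f(i := X) \<in> PiE C A"
      using goodD(1)[OF that(1)] BA[OF that(3)] that(2) by (auto simp: PiE_iff extensional_def)
    ultimately show ?thesis
      using that by (auto simp: good_def)
  qed
  define m where "m = Max (card ` {I. \<exists>f. good f I})"
  have fin_good: "finite (card ` {I. \<exists>f. good f I})"
  proof (rule finite_imageI, rule finite_subset)
    show "{I. \<exists>f. good f I} \<subseteq> Pow C" using goodD(2) by blast
    show "finite (Pow C)" using C(1) by simp
  qed
  have "good (restrict V C) {}" using V by (simp add: good_def disjoint_family_on_def)
  then have "m \<in> card ` {I. \<exists>f. good f I}"
    unfolding m_def using fin_good by (intro Max_in) auto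
  then obtain f1 I1 where fI1: "good f1 I1" "card I1 = m" by blast
  have m_max: "card I \<le> m" if "good f I" for f I
    unfolding m_def using fin_good that by (intro Max_ge) auto
  show ?thesis
  proof (cases "n \<le> m")
    case True
    then show ?thesis
      using fI1(2) goodD(2,4,5)[OF fI1(1)] BA unfolding C_def
      by (intro is_SDR_of_disjoint_family[of I1 _ _ f1]) blast+
  next
    case False
    let ?hi = "\<lambda>f I. \<Sum>k\<in>I. hi (f k)"
    let ?lo = "\<lambda>f I. \<Sum>k\<in>I. lo (f k)"
    define P where "P = {(f, I). good f I \<and> card I = m}"
    have "finite P" by (rule finite_subset[OF _ finP]) (auto simp: P_def good_def)
    moreover have "P \<noteq> {}" using fI1 by (auto simp: P_def)
    ultimately obtain z where "is_arg_min (\<lambda>(f, I). ?hi f I) (\<lambda>z. z \<in> P) z"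
      using ex_is_arg_min_if_finite by blast
    then obtain f2 I2 where fI2: "(f2, I2) \<in> P"
      and min2: "\<And>f I. (f, I) \<in> P \<Longrightarrow> ?hi f2 I2 \<le> ?hi f I"
      by (cases z) (fastforce simp: is_arg_min_linorder)
    \<comment> \<open>\<open>I\<close> and \<open>J\<close> share the choice \<open>f\<close>, so that mixing segments from both keeps their indices distinct.\<close>
    define Q where "Q = {(f, I, J). (f, I) \<in> P \<and> (f, J) \<in> P \<and> ?hi f I = ?hi f2 I2}"
    have "finite Q"
    proof (rule finite_subset)
      show "Q \<subseteq> PiE C A \<times> Pow C \<times> Pow C" by (auto simp: Q_def P_def good_def)
      show "finite (PiE C A \<times> Pow C \<times> Pow C)"
        using C(1) finA by (intro finite_cartesian_product finite_PiE) auto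
    qed
    \<comment> \<open>The witness is \<open>(f2, I2, I2)\<close>.\<close>
    moreover have "Q \<noteq> {}" using fI2 by (auto simp: Q_def)
    \<comment> \<open>The negation turns the maximisation of the left endpoint sum over
      \<open>J\<close> into an \<open>is_arg_min\<close>.\<close>
    ultimately obtain z where "is_arg_min (\<lambda>(f, I, J). - ?lo f J) (\<lambda>z. z \<in> Q) z"
      using ex_is_arg_min_if_finite by blast
    then obtain f I J where fIJ: "(f, I, J) \<in> Q"
      and minQ: "\<And>f' I' J'. (f', I', J') \<in> Q \<Longrightarrow> ?lo f' J' \<le> ?lo f J"
      by (cases z) (fastforce simp: is_arg_min_linorder)
    have gI: "good f I" "card I = m" and gJ: "good f J" "card J = m" and hiI: "?hi f I = ?hi f2 I2"
      using fIJ by (auto simp: Q_def P_def)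
    have finIJ: "finite I" "finite J" by (rule goodD(3)[OF gI(1)], rule goodD(3)[OF gJ(1)])
    have "card (I \<union> J) < card C"
      using card_Un_le[of I J] gI gJ False C(2) by linarith
    then have "\<not> C \<subseteq> I \<union> J" using card_mono[of "I \<union> J" C] finIJ by fastforce
    then obtain i where i: "i \<in> C - I" "i \<in> C - J" by blast
    \<comment> \<open>Otherwise adding \<open>i\<close> would give a good index set of size
      \<open>m + 1\<close>. This rules out the first alternative of the exchange lemmas.\<close>
    have not_all: "\<not> (\<forall>k\<in>K. disjnt x (f k))" if "good f K" "card K = m" "i \<in> C - K" "x \<in> B i" for K x
    proof
      assume "\<forall>k\<in>K. disjnt x (f k)"
      then have "card (insert i K) \<le> m"
        using update[of f K K i x] that m_max by blast
      then show False using that goodD(3)[OF that(1)] by simp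
    qed
    have swap_card: "card (insert i (K - {k})) = m" if "good f K" "card K = m" "i \<in> C - K" "k \<in> K" for K k
      using that goodD(3)[OF that(1)] by (simp add: card.insert_remove card_Suc_Diff1 del: card_Diff_insert)
    have ex_I: "\<exists>k\<in>I. (hi (f k), height (f k)) \<in> x" if x: "x \<in> B i" for x
    proof (rule ccontr)
      assume "\<not> ?thesis"
      then obtain k where k: "k \<in> I" "hi x < hi (f k)" "\<forall>j\<in>I - {k}. disjnt x (f j)"
        using horizontal_exchange_hi[of I f x] goodD[OF gI(1)] horB x i not_all[OF gI i(1) x] by blast
      have "(f(i := x), insert i (I - {k})) \<in> P"
        using update[OF gI(1), of "I - {k}" i x] swap_card[OF gI i(1) k(1)] k i x by (auto simp: P_def)
      \<comment> \<open>By \<open>hiI\<close> the pair \<open>f\<close>, \<open>I\<close> also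
        attains the minimum, which the exchange would undercut.\<close>
      from min2[OF this] show False
        using sum_update_swap[OF finIJ(1) k(1), of i hi f x] i k(2) hiI by simp
    qed
    have ex_J: "\<exists>k\<in>J. (lo (f k), height (f k)) \<in> x" if x: "x \<in> B i" for x
    proof (rule ccontr)
      assume "\<not> ?thesis"
      then obtain k where k: "k \<in> J" "lo (f k) < lo x" "\<forall>j\<in>J - {k}. disjnt x (f j)"
        using horizontal_exchange_lo[of J f x] goodD[OF gJ(1)] horB x i not_all[OF gJ i(2) x] by blast
      have "(f(i := x), insert i (J - {k})) \<in> P"
        using update[OF gJ(1), of "J - {k}" i x] swap_card[OF gJ i(2) k(1)] k i x by (auto simp: P_def)
      moreover have "(f(i := x), I) \<in> P"
        using update_other[OF gI(1) i(1) x] gI(2) by (simp add: P_def)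
      \<comment> \<open>Since \<open>i\<close> is outside \<open>I\<close> as well as
        \<open>J\<close>, the exchange in \<open>J\<close> keeps the right endpoint sum over
        \<open>I\<close> minimal, so the new triple stays in \<open>Q\<close>.\<close>
      moreover have "?hi (f(i := x)) I = ?hi f I"
        using i by (intro sum.cong) auto
      ultimately have "(f(i := x), I, insert i (J - {k})) \<in> Q"
        using hiI by (simp add: Q_def)
      from minQ[OF this] show False
        using sum_update_swap[OF finIJ(2) k(1), of i lo f x] i k(2) by simp
    qed
    obtain \<beta> where \<beta>: "\<And>x. x \<in> B i \<Longrightarrow> \<beta> x \<in> I \<and> (hi (f (\<beta> x)), height (f (\<beta> x))) \<in> x"
      using ex_I by metis
    obtain \<gamma> where \<gamma>: "\<And>x. x \<in> B i \<Longrightarrow> \<gamma> x \<in> J \<and> (lo (f (\<gamma> x)), height (f (\<gamma> x))) \<in> x"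
      using ex_J by metis
    have iC: "i \<in> C" using i by blast
    have disjA: "pairwise disjnt (A i)" using assms(3) iC by (simp add: C_def)
    obtain a where a: "V i \<subseteq> {a} \<times> UNIV" using V[OF iC] by (auto simp: vertical_segment_def)
    have disjB: "pairwise disjnt (B i)" using disjA by (rule pairwise_subset) (auto simp: B_def)
    have VB: "disjnt (V i) x" if "x \<in> B i" for x
      using disjA V[OF iC] that by (auto simp: pairwise_def B_def)
    have horIJ: "horizontal_segment (f k)" if "k \<in> I \<union> J" for k
      using that goodD(6) gI(1) gJ(1) by blast
    obtain K where K: "K \<subseteq> I \<union> J" "card K = card (B i)" "disjoint_family_on f K"
      "\<And>k. k \<in> K \<Longrightarrow> disjnt (V i) (f k)"
      by (rule merge_around_vertical[OF horB[OF iC] disjB horIJ goodD(4)[OF gI(1)]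
          goodD(4)[OF gJ(1)] \<beta> \<gamma> a VB]) (assumption | rule that)+
    have "finite K" using K(1) finIJ by (meson finite_UnI finite_subset)
    \<comment> \<open>\<open>i\<close> avoids both \<open>I\<close> and \<open>J\<close>, so the
      index of \<open>V i\<close> is new.\<close>
    moreover have iK: "i \<notin> K" using K(1) i by blast
    ultimately have "card (insert i K) = n" using K(2) cardB[OF iC] assms(1) by simp
    moreover have "disjoint_family_on (f(i := V i)) (insert i K)"
      using K(3,4) iK by (intro disjoint_family_on_update) auto
    moreover have "insert i K \<subseteq> {1..2 * n - 1}"
      using K(1) iC goodD(2)[OF gI(1)] goodD(2)[OF gJ(1)] by (auto simp: C_def)
    moreover have "(f(i := V i)) k \<in> A k" if "k \<in> insert i K" for k
      using that K(1) V[OF iC] BA goodD(5)[OF gI(1)] goodD(5)[OF gJ(1)] by auto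
    ultimately show ?thesis
      by (intro is_SDR_of_disjoint_family[of "insert i K" _ _ "f(i := V i)"]) auto
  qed
qed

end
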